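(* Let $\mathcal H$ be a real Hilbert space, $p\ge 1$, and let $\mathcal J:\mathcal H\to\mathbb R\cup\{+\infty\}$ be absolutely $p$-homogeneous, proper, convex and lower semicontinuous, and assume that the sublevel sets of $u\mapsto \|u\|+\mathcal J(u)$ are precompact in $\mathcal H$. Let $u:[0,\infty)\to\mathcal H$ be the gradient flow of $\mathcal J$ with initial datum $f\in\overline{\mathrm{dom}(\mathcal J)}$, let $u_\infty:=\lim_{t\to\infty}u(t)$, and let $T_{\mathrm{ex}}\in[0,\infty]$ be its extinction time; assume $f\ne u_\infty$. For $0\le t<T_{\mathrm{ex}}$ set $w(t):=\frac{u(t)-u_\infty}{\|u(t)-u_\infty\|}$, and for $0<t<T_{\mathrm{ex}}$ set $\Lambda(t):=\frac{p\,\mathcal J(u(t))}{\|u(t)-u_\infty\|^p}$. Then there exist a non-decreasing sequence $(t_n)_{n\in\mathbb N}\subset[0,T_{\mathrm{ex}})$ and $w_\infty\in\mathcal H$ such that $\lim_{n\to\infty}t_n=T_{\mathrm{ex}}$ and $\lim_{n\to\infty}w(t_n)=w_\infty$ in $\mathcal H$. Furthermore, $\Lambda_\infty w_\infty\in\partial\mathcal J(w_\infty)$, where $\Lambda_\infty:=\lim_{t\to T_{\mathrm{ex}}}\Lambda(t)=\inf_{0<t<T_{\mathrm{ex}}}\Lambda(t)$.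
   Context: $\mathcal J$ is absolutely $p$-homogeneous if $\mathcal J(0)=0$ and $\mathcal J(cu)=|c|^p\mathcal J(u)$ for all $c\neq0$, $u\in\mathcal H$; it is proper if it is finite somewhere; $\mathrm{dom}(\mathcal J)=\{\mathcal J<\infty\}$. The subdifferential is $\partial\mathcal J(u)=\{\zeta\in\mathcal H:\mathcal J(v)\ge\mathcal J(u)+\langle\zeta,v-u\rangle\ \forall v\in\mathcal H\}$. The null space $\mathcal N_{\mathcal J}=\{u:\mathcal J(u)=0\}$ is a closed linear subspace. For $f\in\overline{\mathrm{dom}(\mathcal J)}$, the gradient flow of $\mathcal J$ with initial datum $f$ is the unique continuous map $u:[0,\infty)\to\mathcal H$ with $u(0)=f$ which is Lipschitz on $[\delta,\infty)$ for every $\delta>0$, right-differentiable on $(0,\infty)$, and satisfies $-\partial_t^+u(t)=\zeta(t)$ for all $t>0$, where $\zeta(t)$ is the element of minimal norm in $\partial\mathcal J(u(t))$ (Brezis). It is known that $u(t)\to u_\infty=P_{\mathcal N_{\mathcal J}}f$ (orthogonal projection onto $\mathcal N_{\mathcal J}$) as $t\to\infty$. The extinction time is $T_{\mathrm{ex}}:=\inf\{t>0:u(t)=u_\infty\}\in[0,\infty]$ with $\inf\emptyset=\infty$. *)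

theory Defs
  imports "HOL-Analysis.Analysis"
begin

text \<open>
  A real Hilbert space is a type of sort \<open>{real_inner, complete_space}\<close>.  Functionals with values in
  the reals extended by plus infinity are functions into \<open>ereal\<close> that avoid \<open>-\<infinity>\<close>
  (predicate \<open>no_minus_infty\<close>).
\<close>

definition no_minus_infty :: "('a \<Rightarrow> ereal) \<Rightarrow> bool" where
  "no_minus_infty J \<longleftrightarrow> (\<forall>u. J u \<noteq> -\<infinity>)"

definition eff_dom :: "('a \<Rightarrow> ereal) \<Rightarrow> 'a set" where
  "eff_dom J = {u. J u < \<infinity>}"

definition proper_fun :: "('a \<Rightarrow> ereal) \<Rightarrow> bool" where
  "proper_fun J \<longleftrightarrow> (\<exists>u. \<bar>J u\<bar> \<noteq> \<infinity>)"

definition abs_homogeneous :: "real \<Rightarrow> ('a::real_vector \<Rightarrow> ereal) \<Rightarrow> bool" where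
  "abs_homogeneous p J \<longleftrightarrow>
     J 0 = 0 \<and> (\<forall>c u. c \<noteq> 0 \<longrightarrow> J (c *\<^sub>R u) = ereal (\<bar>c\<bar> powr p) * J u)"

definition convex_fun :: "('a::real_vector \<Rightarrow> ereal) \<Rightarrow> bool" where
  "convex_fun J \<longleftrightarrow>
     (\<forall>u v. \<forall>s\<in>{0<..<1}.
        J ((1 - s) *\<^sub>R u + s *\<^sub>R v) \<le> ereal (1 - s) * J u + ereal s * J v)"

definition lower_semicont :: "('a::topological_space \<Rightarrow> ereal) \<Rightarrow> bool" where
  "lower_semicont J \<longleftrightarrow> (\<forall>u. J u \<le> Liminf (at u) J)"

definition precompact_sublevels :: "('a::real_normed_vector \<Rightarrow> ereal) \<Rightarrow> bool" where
  "precompact_sublevels J \<longleftrightarrow>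
     (\<forall>c::real. compact (closure {u. ereal (norm u) + J u \<le> ereal c}))"

definition subdifferential :: "('a::real_inner \<Rightarrow> ereal) \<Rightarrow> 'a \<Rightarrow> 'a set" where
  "subdifferential J u = {\<zeta>. \<forall>v. J v \<ge> J u + ereal (inner \<zeta> (v - u))}"

text \<open>
  Curves on the half-line are functions on the reals of which only the values at nonnegative times
  matter.  By Brezis' theorem the predicate below determines them there.
\<close>

definition gradient_flow ::
  "('a::{real_inner, complete_space} \<Rightarrow> ereal) \<Rightarrow> 'a \<Rightarrow> (real \<Rightarrow> 'a) \<Rightarrow> bool" where
  "gradient_flow J f u \<longleftrightarrow>
     u 0 = f \<and>
     continuous_on {0..} u \<and>
     (\<forall>\<delta>>0. \<exists>L. L-lipschitz_on {\<delta>..} u) \<and>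
     (\<forall>t>0. \<exists>\<zeta>. is_arg_min norm (\<lambda>z. z \<in> subdifferential J (u t)) \<zeta> \<and>
        (u has_vector_derivative - \<zeta>) (at_right t))"

definition flow_limit :: "(real \<Rightarrow> 'a::t2_space) \<Rightarrow> 'a" where
  "flow_limit u = Lim at_top u"

definition extinction_time :: "(real \<Rightarrow> 'a::t2_space) \<Rightarrow> ereal" where
  "extinction_time u = Inf (ereal ` {t. t > 0 \<and> u t = flow_limit u})"

definition rescaled_flow :: "(real \<Rightarrow> 'a::real_normed_vector) \<Rightarrow> real \<Rightarrow> 'a" where
  "rescaled_flow u t = (u t - flow_limit u) /\<^sub>R norm (u t - flow_limit u)"

definition rayleigh ::
  "real \<Rightarrow> ('a::real_normed_vector \<Rightarrow> ereal) \<Rightarrow> (real \<Rightarrow> 'a) \<Rightarrow> real \<Rightarrow> ereal" where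
  "rayleigh p J u t = ereal p * J (u t) / ereal (norm (u t - flow_limit u) powr p)"

end

theory Submission
  imports Defs
begin

text \<open>
  Translating by \<open>u\<^sub>\<infinity>\<close> changes neither the energy nor its subdifferential, because \<open>J\<close> is invariant
  under translation by its null space; so let \<open>u\<close> be a curve with \<open>u' = - \<zeta>\<close>, \<open>\<zeta> \<in> \<partial>J(u)\<close>, that tends
  to \<open>0\<close> at the end \<open>T\<close> of its life.  Write \<open>N = \<parallel>u\<parallel>\<close>, \<open>w = u/N\<close> and \<open>\<Lambda> = p J(u)/N\<^sup>p\<close>.  Homogeneity
  gives Euler's identity \<open>\<langle>\<zeta>, u\<rangle> = p J(u)\<close> and shows that \<open>\<eta> = \<zeta>/N\<^sup>p\<^sup>-\<^sup>1\<close> is a subgradient at \<open>w\<close>, with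
  \<open>\<langle>\<eta>, w\<rangle> = \<Lambda>\<close>.  So \<open>\<eta> - \<Lambda> w\<close>, the defect, measures how far \<open>w\<close> is from being an eigenvector.  Since
  energy dissipates at rate \<open>\<parallel>\<zeta>\<parallel>\<^sup>2\<close>, one computes
  \<open>\<Lambda>' = - p N\<^sup>p\<^sup>-\<^sup>2 \<parallel>\<eta> - \<Lambda> w\<parallel>\<^sup>2\<close> and \<open>(ln N)' = - \<Lambda> N\<^sup>p\<^sup>-\<^sup>2\<close>.

  The first identity makes \<open>\<Lambda>\<close> non-increasing, hence convergent to its infimum.  If the defect stayed
  away from \<open>0\<close>, then comparing the two identities would bound \<open>ln N\<close> below by a multiple of \<open>\<Lambda>\<close> plus
  a constant, whereas \<open>ln N \<rightarrow> -\<infinity>\<close> at \<open>T\<close>, both for finite and for infinite \<open>T\<close>.  So the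
  defect is arbitrarily small at times arbitrarily close to \<open>T\<close> (lemma \<open>small_defect\<close>).  Along such
  times the points \<open>w\<close> have norm one and bounded energy, so compactness yields a limit \<open>w\<^sub>\<infinity>\<close>; there
  \<open>\<eta>\<close> tends to \<open>\<Lambda>\<^sub>\<infinity> w\<^sub>\<infinity>\<close> in norm, and the graph of \<open>\<partial>J\<close> is closed.

  Two ingredients on the flow are proved along the way: the energy has right derivative
  \<open>- \<parallel>\<zeta>\<parallel>\<^sup>2\<close> at every positive time (lemma \<open>energy_right_derivative\<close>), and the flow converges to a
  point of the null space (lemma \<open>convergent_at_top\<close>).  All differential inequalities are integrated
  with one-sided derivatives only, which avoids differentiability almost everywhere.
\<close>

section \<open>Calculus with right derivatives\<close>

text \<open>
  If \<open>\<phi>\<close> rose above the line of slope \<open>\<epsilon>\<close> through its starting point, then the slope condition would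
  fail at the last time at which it lies on or below that line.  The hypothesis bounds upper right Dini
  derivatives, so it also covers the energy before that is known to have right derivatives.
\<close>

lemma le_of_right_slopes_nonpos:
  fixes \<phi> :: "real \<Rightarrow> real"
  assumes "a \<le> b" and cont: "continuous_on {a..b} \<phi>"
    and slope: "\<And>t \<epsilon>. a \<le> t \<Longrightarrow> t < b \<Longrightarrow> 0 < \<epsilon> \<Longrightarrow>
      eventually (\<lambda>s. \<phi> s \<le> \<phi> t + \<epsilon> * (s - t)) (at_right t)"
  shows "\<phi> b \<le> \<phi> a"
proof -
  have bound: "\<phi> b \<le> \<phi> a + \<epsilon> * (b - a)" if "0 < \<epsilon>" for \<epsilon>
  proof (rule ccontr)
    assume above: "\<not> \<phi> b \<le> \<phi> a + \<epsilon> * (b - a)"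
    define \<psi> where "\<psi> t = \<phi> t - \<phi> a - \<epsilon> * (t - a)" for t
    define S where "S = {t \<in> {a..b}. \<psi> t \<in> {..0}}"
    have "continuous_on {a..b} \<psi>"
      unfolding \<psi>_def by (intro continuous_intros cont)
    then have "closed S"
      unfolding S_def using continuous_closed_preimage[of "{a..b}" \<psi> "{..0}"]
      by (simp add: vimage_def Int_def)
    moreover have "bounded S"
      unfolding S_def by (rule bounded_subset[of "{a..b}"]) auto
    ultimately have "compact S"
      by (simp add: compact_eq_bounded_closed)
    moreover have "a \<in> S"
      using \<open>a \<le> b\<close> by (simp add: S_def \<psi>_def)
    ultimately obtain c where c: "c \<in> S" "\<And>t. t \<in> S \<Longrightarrow> t \<le> c"
      using compact_attains_sup[of S] by auto
    have "b \<notin> S"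
      using above by (simp add: S_def \<psi>_def)
    then have cb: "a \<le> c" "c < b" "\<psi> c \<le> 0"
      using c by (auto simp: S_def less_le)
    have "eventually (\<lambda>s. \<phi> s \<le> \<phi> c + \<epsilon> * (s - c) \<and> s < b \<and> c < s) (at_right c)"
      using slope[OF cb(1,2) that] cb(2)
      by (intro eventually_conj) (auto simp: eventually_at_right_less eventually_at_right intro: exI[of _ b])
    then obtain s where "\<phi> s \<le> \<phi> c + \<epsilon> * (s - c)" "s < b" "c < s"
      using eventually_happens by (metis (lifting) trivial_limit_at_right_real)
    then have "s \<in> S"
      using cb by (auto simp: S_def \<psi>_def algebra_simps)
    then show False
      using c(2) \<open>c < s\<close> by force
  qed
  show ?thesis
  proof (rule field_le_epsilon)
    fix e :: real assume "0 < e"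
    define \<epsilon> where "\<epsilon> = e / (b - a + 1)"
    have "0 < \<epsilon>" "\<epsilon> * (b - a) \<le> e"
      using \<open>a \<le> b\<close> \<open>0 < e\<close> by (auto simp: \<epsilon>_def field_simps)
    then show "\<phi> b \<le> \<phi> a + e"
      using bound[of \<epsilon>] by linarith
  qed
qed

lemma right_derivative_imp_eventually_le:
  fixes \<phi> :: "real \<Rightarrow> real"
  assumes "(\<phi> has_real_derivative D) (at_right t)" "D < E"
  shows "eventually (\<lambda>s. \<phi> s \<le> \<phi> t + E * (s - t)) (at_right t)"
proof -
  have "((\<lambda>s. (\<phi> s - \<phi> t) / (s - t)) \<longlongrightarrow> D) (at_right t)"
    using assms(1) by (simp add: has_field_derivative_iff)
  then have "eventually (\<lambda>s. (\<phi> s - \<phi> t) / (s - t) < E) (at_right t)"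
    using assms(2) by (rule order_tendstoD)
  moreover have "eventually (\<lambda>s. t < s) (at_right t)"
    by (simp add: eventually_at_right_less)
  ultimately show ?thesis
    by eventually_elim (simp add: field_simps)
qed

lemma le_of_right_derivative_nonpos:
  fixes \<phi> :: "real \<Rightarrow> real"
  assumes "a \<le> b" "continuous_on {a..b} \<phi>"
    and der: "\<And>t. a \<le> t \<Longrightarrow> t < b \<Longrightarrow> (\<phi> has_real_derivative D t) (at_right t)"
    and "\<And>t. a \<le> t \<Longrightarrow> t < b \<Longrightarrow> D t \<le> 0"
  shows "\<phi> b \<le> \<phi> a"
  using assms(1,2)
proof (rule le_of_right_slopes_nonpos)
  fix t \<epsilon> :: real assume "a \<le> t" "t < b" "0 < \<epsilon>"
  then show "eventually (\<lambda>s. \<phi> s \<le> \<phi> t + \<epsilon> * (s - t)) (at_right t)"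
    using assms(4)[of t] by (intro right_derivative_imp_eventually_le[OF der]) auto
qed

lemma has_right_derivative_norm_sq:
  fixes x :: "real \<Rightarrow> 'a::real_inner"
  assumes "(x has_vector_derivative d) (at_right t)"
  shows "((\<lambda>s. (norm (x s))\<^sup>2) has_real_derivative 2 * inner d (x t)) (at_right t)"
  using bounded_bilinear.has_vector_derivative[OF bounded_bilinear_inner assms assms]
  by (simp add: power2_norm_eq_inner has_real_derivative_iff_has_vector_derivative inner_commute)

lemma has_right_derivative_norm:
  fixes x :: "real \<Rightarrow> 'a::real_inner"
  assumes "(x has_vector_derivative d) (at_right t)" "x t \<noteq> 0"
  shows "((\<lambda>s. norm (x s)) has_real_derivative inner d (x t) / norm (x t)) (at_right t)"
  using DERIV_chain2[OF DERIV_real_sqrt has_right_derivative_norm_sq[OF assms(1)]] assms(2)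
  by (simp add: field_simps)

lemma has_vector_derivative_right_quotient:
  fixes x :: "real \<Rightarrow> 'a::real_normed_vector"
  assumes "(x has_vector_derivative d) (at_right t)"
  shows "((\<lambda>h. (x (t + h) - x t) /\<^sub>R h) \<longlongrightarrow> d) (at_right 0)"
proof -
  have "((\<lambda>s. (1 / norm (s - t)) *\<^sub>R (x s - (x t + (s - t) *\<^sub>R d))) \<longlongrightarrow> 0) (at_right t)"
    using assms by (simp add: has_vector_derivative_def has_derivative_within)
  then have "((\<lambda>h. (1 / norm h) *\<^sub>R (x (h + t) - (x t + h *\<^sub>R d))) \<longlongrightarrow> 0) (at_right 0)"
    by (subst (asm) filterlim_at_right_to_0) simp
  moreover have "eventually (\<lambda>h::real. 0 < h) (at_right 0)"
    by (simp add: eventually_at_right_less)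
  then have "eventually (\<lambda>h. (1 / norm h) *\<^sub>R (x (h + t) - (x t + h *\<^sub>R d))
      = (x (t + h) - x t) /\<^sub>R h - d) (at_right 0)"
    by eventually_elim (simp add: algebra_simps inverse_eq_divide)
  ultimately have "((\<lambda>h. (x (t + h) - x t) /\<^sub>R h - d) \<longlongrightarrow> 0) (at_right 0)"
    by (rule Lim_transform_eventually)
  then show ?thesis
    by (simp add: LIM_zero_iff)
qed

lemma has_vector_derivative_right_shift:
  fixes x :: "real \<Rightarrow> 'a::real_normed_vector"
  assumes "(x has_vector_derivative d) (at_right (t + h))"
  shows "((\<lambda>r. x (r + h)) has_vector_derivative d) (at_right t)"
proof -
  have "((\<lambda>r. h + r) has_vector_derivative 1) (at_right t)"
    by (auto intro!: derivative_eq_intros)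
  moreover have "(\<lambda>r. h + r) ` {t<..} = {h + t<..}"
  proof (intro set_eqI iffI)
    fix y assume "y \<in> {h + t<..}"
    then show "y \<in> (\<lambda>r. h + r) ` {t<..}"
      by (intro image_eqI[of _ _ "y - h"]) auto
  qed auto
  then have "(x has_vector_derivative d) (at (h + t) within (\<lambda>r. h + r) ` {t<..})"
    using assms by (metis add.commute)
  ultimately have "(x \<circ> (\<lambda>r. h + r) has_vector_derivative 1 *\<^sub>R d) (at_right t)"
    by (rule vector_diff_chain_within)
  then show ?thesis
    by (simp add: o_def add.commute)
qed

section \<open>Absolutely homogeneous convex functionals\<close>

locale homogeneous_functional =
  fixes J :: "'a::real_inner \<Rightarrow> ereal" and p :: real
  assumes p_ge_1: "1 \<le> p"
    and no_minus_infty: "no_minus_infty J"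
    and abs_homogeneous: "abs_homogeneous p J"
    and convex_fun: "convex_fun J"
    and lower_semicont: "lower_semicont J"
begin

lemma J_zero: "J 0 = 0"
  using abs_homogeneous by (simp add: abs_homogeneous_def)

lemma J_scale: "c \<noteq> 0 \<Longrightarrow> J (c *\<^sub>R x) = ereal (\<bar>c\<bar> powr p) * J x"
  using abs_homogeneous by (simp add: abs_homogeneous_def)

lemma J_uminus: "J (- x) = J x"
  using J_scale[of "-1" x] by simp

text \<open>
  By evenness and convexity, \<open>0 = J 0\<close> is at most the mean of \<open>J x\<close> and \<open>J (- x)\<close>.
\<close>

lemma J_nonneg: "0 \<le> J x"
proof -
  have "J ((1 - 1/2) *\<^sub>R x + (1/2) *\<^sub>R (- x)) \<le> ereal (1 - 1/2) * J x + ereal (1/2) * J (- x)"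
    using convex_fun[unfolded convex_fun_def, rule_format, of "1/2" x "- x"] by simp
  then have "0 \<le> ereal (1/2) * J x + ereal (1/2) * J x"
    by (simp add: J_zero J_uminus)
  moreover have "J x \<noteq> - \<infinity>"
    using no_minus_infty by (simp add: no_minus_infty_def)
  ultimately show ?thesis
    by (cases "J x") auto
qed

lemma subgradient_imp_finite:
  assumes "\<zeta> \<in> subdifferential J x"
  shows "J x = ereal (real_of_ereal (J x))" and "0 \<le> real_of_ereal (J x)"
proof -
  have "J x + ereal (inner \<zeta> (0 - x)) \<le> J 0"
    using assms unfolding subdifferential_def by blast
  then show "J x = ereal (real_of_ereal (J x))"
    using J_nonneg[of x] by (cases "J x") (auto simp: J_zero)
  show "0 \<le> real_of_ereal (J x)"
    using J_nonneg by (simp add: real_of_ereal_pos)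
qed

lemma subgradient_ineq:
  assumes "\<zeta> \<in> subdifferential J x" "\<zeta>' \<in> subdifferential J y"
  shows "real_of_ereal (J x) + inner \<zeta> (y - x) \<le> real_of_ereal (J y)"
proof -
  have "J x + ereal (inner \<zeta> (y - x)) \<le> J y"
    using assms(1) by (simp add: subdifferential_def)
  then show ?thesis
    using subgradient_imp_finite(1)[OF assms(1)] subgradient_imp_finite(1)[OF assms(2)]
    by (metis ereal_less_eq(3) plus_ereal.simps(1))
qed

text \<open>
  Euler's identity: \<open>c \<mapsto> J (c x) - J x - (c - 1) \<langle>\<zeta>, x\<rangle>\<close> is nonnegative and vanishes at \<open>c = 1\<close>, so its
  derivative there is zero.
\<close>

lemma inner_subgradient_self:
  assumes \<zeta>: "\<zeta> \<in> subdifferential J x"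
  shows "inner \<zeta> x = p * real_of_ereal (J x)"
proof -
  define j where "j = real_of_ereal (J x)"
  have j: "J x = ereal j"
    using subgradient_imp_finite[OF \<zeta>] by (simp add: j_def)
  define h where "h c = c powr p * j - (c - 1) * inner \<zeta> x" for c
  have "h 1 \<le> h c" if "\<bar>1 - c\<bar> < 1" for c
  proof -
    have "J x + ereal (inner \<zeta> (c *\<^sub>R x - x)) \<le> J (c *\<^sub>R x)"
      using \<zeta> by (simp add: subdifferential_def)
    moreover have "J (c *\<^sub>R x) = ereal (c powr p * j)"
      using that by (subst J_scale) (auto simp: j)
    ultimately have "j + inner \<zeta> (c *\<^sub>R x - x) \<le> c powr p * j"
      by (simp add: j)
    then show ?thesis
      by (simp add: h_def algebra_simps inner_diff_right)
  qed
  moreover have "(h has_real_derivative p * j - inner \<zeta> x) (at 1)"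
    unfolding h_def by (auto intro!: derivative_eq_intros)
  ultimately have "p * j - inner \<zeta> x = 0"
    by (intro DERIV_local_min[of h _ 1 1]) auto
  then show ?thesis
    by (simp add: j_def)
qed

text \<open>
  The point \<open>x + n\<close> is the convex combination, with weights \<open>1 - s\<close> and \<open>s\<close>, of \<open>x / (1 - s)\<close> and
  \<open>n / s\<close>.  The second of these costs nothing, however small \<open>s\<close> is, and the first costs about \<open>J x\<close>.
\<close>

lemma J_add_null_le:
  assumes "J n = 0"
  shows "J (x + n) \<le> J x"
proof (cases "J x")
  case (real r)
  have le: "J (x + n) \<le> ereal ((1 - s) powr (1 - p) * r)" if "0 < s" "s < 1" for s
  proof -
    have "J ((1 - s) *\<^sub>R (x /\<^sub>R (1 - s)) + s *\<^sub>R (n /\<^sub>R s))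
        \<le> ereal (1 - s) * J (x /\<^sub>R (1 - s)) + ereal s * J (n /\<^sub>R s)"
      using that by (intro convex_fun[unfolded convex_fun_def, rule_format]) simp
    also have "J (n /\<^sub>R s) = 0"
      using that assms by (simp add: J_scale)
    also have "J (x /\<^sub>R (1 - s)) = ereal ((1 - s) powr (- p) * r)"
      using that by (simp add: J_scale real powr_minus powr_divide inverse_eq_divide)
    also have "(1 - s) *\<^sub>R (x /\<^sub>R (1 - s)) + s *\<^sub>R (n /\<^sub>R s) = x + n"
      using that by simp
    also have "ereal (1 - s) * ereal ((1 - s) powr (- p) * r) + ereal s * 0
        = ereal ((1 - s) powr (1 - p) * r)"
      using that powr_add[of "1 - s" 1 "- p"] by (simp add: mult.assoc)
    finally show ?thesis .
  qed
  have "((\<lambda>s. ereal ((1 - s) powr (1 - p) * r)) \<longlongrightarrow> ereal ((1 - 0) powr (1 - p) * r)) (at_right 0)"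
    by (intro tendsto_intros) auto
  moreover have "eventually (\<lambda>s::real. s \<in> {0<..<1}) (at_right 0)"
    by (rule eventually_at_right_real) simp
  then have "eventually (\<lambda>s. J (x + n) \<le> ereal ((1 - s) powr (1 - p) * r)) (at_right 0)"
    by eventually_elim (auto intro: le)
  ultimately have "J (x + n) \<le> ereal ((1 - 0) powr (1 - p) * r)"
    by (rule tendsto_lowerbound) simp
  then show ?thesis
    by (simp add: real)
qed (use J_nonneg[of x] in auto)

lemma J_add_null:
  assumes "J n = 0"
  shows "J (x + n) = J x"
  using J_add_null_le[OF assms, of x] J_add_null_le[of "- n" "x + n"] assms
  by (simp add: J_uminus)

lemma subdifferential_add_null:
  assumes "J n = 0"
  shows "subdifferential J (x + n) = subdifferential J x"
proof -
  have "subdifferential J x \<subseteq> subdifferential J (x + n)" if "J n = 0" for x n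
  proof
    fix \<zeta> assume "\<zeta> \<in> subdifferential J x"
    then have *: "J x + ereal (inner \<zeta> (v - x)) \<le> J v" for v
      by (simp add: subdifferential_def)
    have "J (x + n) + ereal (inner \<zeta> (v - (x + n))) \<le> J v" for v
      using *[of "v - n"] J_add_null[OF that, of x] J_add_null[OF that, of "v - n"]
      by (simp add: algebra_simps)
    then show "\<zeta> \<in> subdifferential J (x + n)"
      by (simp add: subdifferential_def)
  qed
  from this[of n x] this[of "- n" "x + n"] show ?thesis
    using assms by (auto simp: J_uminus)
qed

lemma subdifferential_scale:
  assumes \<zeta>: "\<zeta> \<in> subdifferential J x" and "0 < c"
  shows "(c powr (p - 1)) *\<^sub>R \<zeta> \<in> subdifferential J (c *\<^sub>R x)"
proof -
  have "J (c *\<^sub>R x) + ereal (inner ((c powr (p - 1)) *\<^sub>R \<zeta>) (v - c *\<^sub>R x)) \<le> J v" for v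
  proof -
    have "J x + ereal (inner \<zeta> (v /\<^sub>R c - x)) \<le> J (v /\<^sub>R c)"
      using \<zeta> by (simp add: subdifferential_def)
    then have "ereal (c powr p) * (J x + ereal (inner \<zeta> (v /\<^sub>R c - x))) \<le> ereal (c powr p) * J (v /\<^sub>R c)"
      by (rule ereal_mult_left_mono) simp
    also have "ereal (c powr p) * J (v /\<^sub>R c) = J v"
      using J_scale[of c "v /\<^sub>R c"] \<open>0 < c\<close> by simp
    also have "ereal (c powr p) * (J x + ereal (inner \<zeta> (v /\<^sub>R c - x)))
        = J (c *\<^sub>R x) + ereal (c powr p * inner \<zeta> (v /\<^sub>R c - x))"
      using J_scale[of c x] \<open>0 < c\<close> subgradient_imp_finite(1)[OF \<zeta>]
      by (cases "J x") (auto simp: algebra_simps)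
    also have "c powr p * inner \<zeta> (v /\<^sub>R c - x) = inner ((c powr (p - 1)) *\<^sub>R \<zeta>) (v - c *\<^sub>R x)"
      using \<open>0 < c\<close> by (simp add: powr_diff inner_diff_right field_simps)
    finally show ?thesis .
  qed
  then show ?thesis
    by (simp add: subdifferential_def)
qed

lemma J_le_of_tendsto:
  assumes "x \<longlonglongrightarrow> l" "r \<longlonglongrightarrow> R" "\<And>n. J (x n) \<le> ereal (r n)"
  shows "J l \<le> ereal R"
proof (rule dense_le)
  fix c assume "c < J l"
  then have "c < Liminf (at l) J"
    using lower_semicont unfolding lower_semicont_def by (meson less_le_trans)
  then have "eventually (\<lambda>z. c < J z) (at l)"
    by (rule less_LiminfD)
  then have "eventually (\<lambda>z. c < J z) (nhds l)"
    using \<open>c < J l\<close> by (simp add: eventually_nhds_conv_at)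
  then have "eventually (\<lambda>n. c < J (x n)) sequentially"
    using assms(1) by (rule eventually_compose_filterlim)
  then have "eventually (\<lambda>n. c \<le> ereal (r n)) sequentially"
    by eventually_elim (use assms(3) in \<open>meson less_imp_le less_le_trans\<close>)
  moreover have "(\<lambda>n. ereal (r n)) \<longlonglongrightarrow> ereal R"
    using assms(2) by simp
  ultimately show "c \<le> ereal R"
    by (intro tendsto_lowerbound) auto
qed

text \<open>
  In the subgradient inequality the only term that is not continuous is \<open>J (x n)\<close>, which stands on the
  small side, where lower semicontinuity suffices.
\<close>

lemma subdifferential_closed:
  assumes "x \<longlonglongrightarrow> l" "\<zeta> \<longlonglongrightarrow> z" "\<And>n. \<zeta> n \<in> subdifferential J (x n)"
  shows "z \<in> subdifferential J l"
proof -
  have "J l + ereal (inner z (v - l)) \<le> J v" for v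
  proof (cases "J v")
    case (real r)
    have "(\<lambda>n. r - inner (\<zeta> n) (v - x n)) \<longlonglongrightarrow> r - inner z (v - l)"
      by (intro tendsto_intros assms)
    moreover have "J (x n) \<le> ereal (r - inner (\<zeta> n) (v - x n))" for n
    proof -
      have "J (x n) + ereal (inner (\<zeta> n) (v - x n)) \<le> J v"
        using assms(3)[of n] by (simp add: subdifferential_def)
      then show ?thesis
        using real by (cases "J (x n)") auto
    qed
    ultimately have "J l \<le> ereal (r - inner z (v - l))"
      by (intro J_le_of_tendsto[OF assms(1)])
    then show ?thesis
      using real by (cases "J l") auto
  qed (use J_nonneg[of v] in auto)
  then show ?thesis
    by (simp add: subdifferential_def)
qed

lemma bounded_energy_imp_convergent_subseq:
  fixes x :: "nat \<Rightarrow> 'a"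
  assumes "precompact_sublevels J" "\<And>n. norm (x n) \<le> A" "\<And>n. J (x n) \<le> ereal B"
  obtains l r where "strict_mono r" "(x \<circ> r) \<longlonglongrightarrow> l"
proof -
  define S where "S = closure {z. ereal (norm z) + J z \<le> ereal (A + B)}"
  have in_S: "\<forall>n. x n \<in> S"
    using add_mono[of "ereal (norm (x n))" "ereal A" "J (x n)" "ereal B" for n] assms(2,3)
    unfolding S_def by (intro allI subsetD[OF closure_subset]) simp
  have S: "seq_compact S"
    using assms(1) by (simp add: S_def precompact_sublevels_def compact_imp_seq_compact)
  show ?thesis
    by (rule seq_compactE[OF S in_S]) (rule that)
qed

end


section \<open>Gradient curves of a homogeneous functional\<close>

text \<open>
  Stability under translation by null elements is what this notion is made for: it allows the limit of
  the flow to be moved to the origin, where Euler's identity speaks of the distance to that limit.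
\<close>

locale homogeneous_flow = homogeneous_functional J p
  for J :: "'a::real_inner \<Rightarrow> ereal" and p :: real +
  fixes u \<zeta> :: "real \<Rightarrow> 'a"
  assumes continuous: "continuous_on {0<..} u"
    and subgradient: "0 < t \<Longrightarrow> \<zeta> t \<in> subdifferential J (u t)"
    and right_derivative: "0 < t \<Longrightarrow> (u has_vector_derivative - \<zeta> t) (at_right t)"
begin

definition energy :: "real \<Rightarrow> real" where
  "energy t = real_of_ereal (J (u t))"

lemma J_eq_energy: "0 < t \<Longrightarrow> J (u t) = ereal (energy t)"
  and energy_nonneg: "0 < t \<Longrightarrow> 0 \<le> energy t"
  using subgradient_imp_finite[OF subgradient] by (auto simp: energy_def)

lemma energy_slope:
  "0 < s \<Longrightarrow> 0 < t \<Longrightarrow> energy s + inner (\<zeta> s) (u t - u s) \<le> energy t"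
  using subgradient_ineq[OF subgradient subgradient] by (simp add: energy_def)

lemma inner_subgradient_flow: "0 < t \<Longrightarrow> inner (\<zeta> t) (u t) = p * energy t"
  using inner_subgradient_self[OF subgradient] by (simp add: energy_def)

lemma continuous_on_interval: "0 < a \<Longrightarrow> continuous_on {a..b} u"
  by (rule continuous_on_subset[OF continuous]) auto

text \<open>
  The squared distance to \<open>x\<close> has right derivative \<open>- 2 \<langle>\<zeta>, u - x\<rangle> \<le> 2 (J x - J u)\<close>.  An affine bound on
  the energy gap therefore integrates to a quadratic bound on the distance.
\<close>

lemma dist_sq_le:
  assumes x: "J x = ereal j" and "0 < c" "0 \<le> h"
    and gap: "\<And>r. c \<le> r \<Longrightarrow> r < c + h \<Longrightarrow> j - energy r \<le> K + (r - c) * M"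
  shows "(norm (u (c + h) - x))\<^sup>2 \<le> (norm (u c - x))\<^sup>2 + 2 * h * K + h\<^sup>2 * M"
proof -
  define \<phi> where "\<phi> r = (norm (u r - x))\<^sup>2 - (2 * (r - c) * K + (r - c)\<^sup>2 * M)" for r
  have "\<phi> (c + h) \<le> \<phi> c"
  proof (rule le_of_right_derivative_nonpos[where \<phi> = \<phi>])
    show "continuous_on {c..c + h} \<phi>"
      unfolding \<phi>_def using \<open>0 < c\<close> by (intro continuous_intros continuous_on_interval)
    fix r assume r: "c \<le> r" "r < c + h"
    then have "0 < r" using \<open>0 < c\<close> by simp
    have "((\<lambda>s. u s - x) has_vector_derivative - \<zeta> r) (at_right r)"
      using right_derivative[OF \<open>0 < r\<close>] by (auto intro!: derivative_eq_intros)
    then show "(\<phi> has_real_derivative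
        2 * inner (- \<zeta> r) (u r - x) - (2 * K + 2 * (r - c) * M)) (at_right r)"
      unfolding \<phi>_def
      by (intro DERIV_diff has_right_derivative_norm_sq) (auto intro!: derivative_eq_intros)
    have "J (u r) + ereal (inner (\<zeta> r) (x - u r)) \<le> J x"
      using subgradient[OF \<open>0 < r\<close>] unfolding subdifferential_def by blast
    then have "inner (- \<zeta> r) (u r - x) \<le> j - energy r"
      using x J_eq_energy[OF \<open>0 < r\<close>] by (simp add: inner_diff_right)
    with gap[OF r] show "2 * inner (- \<zeta> r) (u r - x) - (2 * K + 2 * (r - c) * M) \<le> 0"
      by (simp add: algebra_simps)
  qed (use \<open>0 \<le> h\<close> in simp)
  then show ?thesis
    by (simp add: \<phi>_def)
qed

text \<open>
  Two solutions of the flow do not move apart, since \<open>\<partial>J\<close> is monotone; here the second solution is the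
  first one delayed by \<open>h\<close>.
\<close>

lemma increment_antimono:
  assumes "0 < s" "s \<le> t" "0 < h"
  shows "norm (u (t + h) - u t) \<le> norm (u (s + h) - u s)"
proof -
  define \<phi> where "\<phi> r = (norm (u (r + h) - u r))\<^sup>2" for r
  have "\<phi> t \<le> \<phi> s"
  proof (rule le_of_right_derivative_nonpos[where \<phi> = \<phi>])
    have "continuous_on {s..t} (\<lambda>r. u (r + h))"
      by (rule continuous_on_compose2[OF continuous]) (use assms in \<open>auto intro!: continuous_intros\<close>)
    then show "continuous_on {s..t} \<phi>"
      unfolding \<phi>_def using \<open>0 < s\<close> by (intro continuous_intros continuous_on_interval)
    fix r assume r: "s \<le> r" "r < t"
    then have pos: "0 < r" "0 < r + h" using assms by auto
    have "((\<lambda>q. u (q + h) - u q) has_vector_derivative - \<zeta> (r + h) - (- \<zeta> r)) (at_right r)"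
      by (intro derivative_intros has_vector_derivative_right_shift right_derivative pos)
    from has_right_derivative_norm_sq[OF this]
    show "(\<phi> has_real_derivative
        2 * inner (- \<zeta> (r + h) - (- \<zeta> r)) (u (r + h) - u r)) (at_right r)"
      unfolding \<phi>_def .
    show "2 * inner (- \<zeta> (r + h) - (- \<zeta> r)) (u (r + h) - u r) \<le> 0"
      using energy_slope[OF pos] energy_slope[OF pos(2,1)]
      by (simp add: inner_diff_left inner_diff_right inner_minus_left)
  qed (use assms in simp)
  then show ?thesis
    by (simp add: \<phi>_def abs_le_square_iff[symmetric])
qed

lemma speed_tendsto:
  assumes "0 < t"
  shows "((\<lambda>h. norm (u (t + h) - u t) / h) \<longlongrightarrow> norm (\<zeta> t)) (at_right 0)"
proof -
  have "((\<lambda>h. norm ((u (t + h) - u t) /\<^sub>R h)) \<longlongrightarrow> norm (- \<zeta> t)) (at_right 0)"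
    by (intro tendsto_norm has_vector_derivative_right_quotient right_derivative assms)
  moreover have "eventually (\<lambda>h::real. 0 < h) (at_right 0)"
    by (simp add: eventually_at_right_less)
  then have "eventually (\<lambda>h. norm ((u (t + h) - u t) /\<^sub>R h) = norm (u (t + h) - u t) / h) (at_right 0)"
    by eventually_elim (simp add: divide_inverse_commute)
  ultimately show ?thesis
    by (simp add: Lim_transform_eventually)
qed

lemma norm_subgradient_antimono:
  assumes "0 < s" "s \<le> t"
  shows "norm (\<zeta> t) \<le> norm (\<zeta> s)"
proof (rule tendsto_le[OF _ speed_tendsto speed_tendsto])
  have "eventually (\<lambda>h::real. 0 < h) (at_right 0)"
    by (simp add: eventually_at_right_less)
  then show "eventually (\<lambda>h. norm (u (t + h) - u t) / h \<le> norm (u (s + h) - u s) / h) (at_right 0)"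
    by eventually_elim (auto intro!: divide_right_mono increment_antimono assms)
qed (use assms in auto)

lemma continuous_on_energy:
  assumes "0 < a"
  shows "continuous_on {a..b} energy"
  unfolding continuous_on_def
proof
  fix x assume x: "x \<in> {a..b}"
  have bound: "norm (energy s - energy x) \<le> norm (\<zeta> a) * norm (u s - u x)" if "s \<in> {a..b}" for s
  proof -
    have pos: "0 < s" "0 < x" and le: "a \<le> s" "a \<le> x" using that x assms by auto
    have "\<bar>inner (\<zeta> r) (u s - u x)\<bar> \<le> norm (\<zeta> a) * norm (u s - u x)" if "a \<le> r" for r
      using Cauchy_Schwarz_ineq2[of "\<zeta> r" "u s - u x"]
        mult_right_mono[OF norm_subgradient_antimono[OF assms that] norm_ge_zero[of "u s - u x"]]
      by linarith
    from this[OF le(1)] this[OF le(2)] show ?thesis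
      using energy_slope[OF pos] energy_slope[OF pos(2,1)]
      by (simp add: inner_diff_right abs_le_iff)
  qed
  have "(u \<longlongrightarrow> u x) (at x within {a..b})"
    using continuous_on_interval[OF assms] x by (simp add: continuous_on_def)
  then have lim: "((\<lambda>s. norm (\<zeta> a) * norm (u s - u x)) \<longlongrightarrow> 0) (at x within {a..b})"
    by (intro tendsto_mult_right_zero tendsto_norm_zero) (simp add: LIM_zero_iff)
  have "eventually (\<lambda>s. norm (energy s - energy x) \<le> norm (\<zeta> a) * norm (u s - u x)) (at x within {a..b})"
    unfolding eventually_at_filter using bound by (intro always_eventually) blast
  then have "((\<lambda>s. energy s - energy x) \<longlongrightarrow> 0) (at x within {a..b})"
    using lim by (rule Lim_null_comparison)
  then show "(energy \<longlongrightarrow> energy x) (at x within {a..b})"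
    by (simp add: LIM_zero_iff)
qed

text \<open>
  The subgradient inequality at \<open>u r\<close> bounds the rate of decrease of the energy by \<open>\<parallel>\<zeta> r\<parallel>\<^sup>2\<close>, which does not
  exceed \<open>\<parallel>\<zeta> s\<parallel>\<^sup>2\<close>.  This bounds a Dini derivative only, as a subgradient bounds the energy from one side.
\<close>

lemma energy_drop_le:
  assumes "0 < s" "s \<le> t"
  shows "energy s - energy t \<le> (t - s) * (norm (\<zeta> s))\<^sup>2"
proof -
  define \<phi> where "\<phi> r = - energy r - (r - s) * (norm (\<zeta> s))\<^sup>2" for r
  have "\<phi> t \<le> \<phi> s"
  proof (rule le_of_right_slopes_nonpos[where \<phi> = \<phi>])
    show "continuous_on {s..t} \<phi>"
      unfolding \<phi>_def by (intro continuous_intros continuous_on_energy assms)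
    fix r \<epsilon> :: real assume r: "s \<le> r" "r < t" "0 < \<epsilon>"
    then have "0 < r" using assms by simp
    have "((\<lambda>q. - inner (\<zeta> r) (u q)) has_real_derivative - inner (\<zeta> r) (- \<zeta> r)) (at_right r)"
      using bounded_linear.has_vector_derivative[OF bounded_linear_inner_right right_derivative[OF \<open>0 < r\<close>]]
      by (intro DERIV_minus) (simp add: has_real_derivative_iff_has_vector_derivative)
    moreover have "(norm (\<zeta> r))\<^sup>2 \<le> (norm (\<zeta> s))\<^sup>2"
      using norm_subgradient_antimono r assms by (simp add: power_mono)
    then have "- inner (\<zeta> r) (- \<zeta> r) < (norm (\<zeta> s))\<^sup>2 + \<epsilon>"
      using r by (simp add: power2_norm_eq_inner)
    ultimately have "eventually (\<lambda>q. - inner (\<zeta> r) (u q)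
        \<le> - inner (\<zeta> r) (u r) + ((norm (\<zeta> s))\<^sup>2 + \<epsilon>) * (q - r)) (at_right r)"
      by (rule right_derivative_imp_eventually_le)
    moreover have "eventually (\<lambda>q. r < q) (at_right r)"
      by (simp add: eventually_at_right_less)
    ultimately show "eventually (\<lambda>q. \<phi> q \<le> \<phi> r + \<epsilon> * (q - r)) (at_right r)"
    proof eventually_elim
      case (elim q)
      with energy_slope[of r q] \<open>0 < r\<close> show ?case
        by (simp add: \<phi>_def inner_diff_right algebra_simps)
    qed
  qed (use assms in simp)
  then show ?thesis
    by (simp add: \<phi>_def)
qed

text \<open>
  The distance travelled from \<open>u t\<close> is controlled by the energy lost on the way.  If the energy loss over
  \<open>[t, t + h]\<close> falls short of \<open>h \<parallel>\<zeta> t\<parallel>\<^sup>2\<close>, then by \<open>energy_drop_le\<close>, started at \<open>t + h\<close>, the deficit persists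
  throughout \<open>[t + h, t + 2 h]\<close>, and it shortens the path up to time \<open>t + 2 h\<close>.  Since the length of
  that path is known to first order in \<open>h\<close>, the deficit must be \<open>o(h)\<close>.
\<close>

lemma energy_drop_ge:
  assumes "0 < t" "0 < h"
  shows "energy (t + h) - energy t \<le> h * (norm (\<zeta> t))\<^sup>2 - (norm (u (t + 2 * h) - u t))\<^sup>2 / (2 * h)"
proof -
  let ?a = "(norm (\<zeta> t))\<^sup>2"
  have "(norm (u (t + h) - u t))\<^sup>2 \<le> (norm (u t - u t))\<^sup>2 + 2 * h * 0 + h\<^sup>2 * ?a"
  proof (rule dist_sq_le[OF J_eq_energy])
    fix r assume "t \<le> r"
    then show "energy t - energy r \<le> 0 + (r - t) * ?a"
      using energy_drop_le[OF assms(1)] by simp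
  qed (use assms in simp_all)
  moreover have "(norm (u (t + h + h) - u t))\<^sup>2
      \<le> (norm (u (t + h) - u t))\<^sup>2 + 2 * h * (energy t - energy (t + h)) + h\<^sup>2 * ?a"
  proof (rule dist_sq_le[OF J_eq_energy])
    fix r assume "t + h \<le> r"
    then have "energy (t + h) - energy r \<le> (r - (t + h)) * (norm (\<zeta> (t + h)))\<^sup>2"
      using assms by (intro energy_drop_le) auto
    also have "\<dots> \<le> (r - (t + h)) * ?a"
      using norm_subgradient_antimono[of t "t + h"] assms \<open>t + h \<le> r\<close>
      by (intro mult_left_mono power_mono) auto
    finally show "energy t - energy r \<le> energy t - energy (t + h) + (r - (t + h)) * ?a"
      by simp
  qed (use assms in simp_all)
  ultimately have "(norm (u (t + 2 * h) - u t))\<^sup>2 \<le> 2 * h * (energy t - energy (t + h) + h * ?a)"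
    by (simp add: algebra_simps power2_eq_square)
  then have "(norm (u (t + 2 * h) - u t))\<^sup>2 / (2 * h) \<le> energy t - energy (t + h) + h * ?a"
    using assms by (simp add: pos_divide_le_eq mult.commute)
  then show ?thesis
    by simp
qed

text \<open>
  The difference quotients lie between the bounds of \<open>energy_drop_le\<close> and \<open>energy_drop_ge\<close>.  The latter
  is \<open>\<parallel>\<zeta> t\<parallel>\<^sup>2 - 2 v\<^sup>2\<close>, where \<open>v\<close> is the mean speed over \<open>[t, t + 2 h]\<close> and tends to \<open>\<parallel>\<zeta> t\<parallel>\<close>.  In this way
  no weak compactness of subgradients is involved.
\<close>

lemma energy_right_derivative:
  assumes "0 < t"
  shows "(energy has_real_derivative - (norm (\<zeta> t))\<^sup>2) (at_right t)"
proof -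
  let ?a = "(norm (\<zeta> t))\<^sup>2"
  let ?v = "\<lambda>h. norm (u (t + h) - u t) / h"
  have pos: "eventually (\<lambda>h::real. 0 < h) (at_right 0)"
    by (simp add: eventually_at_right_less)
  have "filterlim (\<lambda>h::real. 2 * h) (at_right 0) (at_right 0)"
    using tendsto_mult[OF tendsto_const[of "2::real"] tendsto_ident_at[of "0::real" "{0<..}"]] pos
    by (auto simp: filterlim_at elim: eventually_mono)
  then have "((\<lambda>h. ?v (2 * h)) \<longlongrightarrow> norm (\<zeta> t)) (at_right 0)"
    by (rule filterlim_compose[OF speed_tendsto[OF assms]])
  then have "((\<lambda>h. ?a - 2 * (?v (2 * h))\<^sup>2) \<longlongrightarrow> ?a - 2 * ?a) (at_right 0)"
    by (intro tendsto_intros)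
  moreover have "eventually (\<lambda>h. - ?a \<le> (energy (t + h) - energy t) / h) (at_right 0)"
    using pos
  proof eventually_elim
    case (elim h)
    with energy_drop_le[of t "t + h"] assms show ?case
      by (simp add: pos_le_divide_eq algebra_simps)
  qed
  moreover have "eventually (\<lambda>h. (energy (t + h) - energy t) / h \<le> ?a - 2 * (?v (2 * h))\<^sup>2) (at_right 0)"
    using pos
  proof eventually_elim
    case (elim h)
    have "(energy (t + h) - energy t) / h \<le> (h * ?a - (norm (u (t + 2 * h) - u t))\<^sup>2 / (2 * h)) / h"
      using energy_drop_ge[OF assms elim] elim by (intro divide_right_mono) auto
    also have "\<dots> = ?a - 2 * (?v (2 * h))\<^sup>2"
      using elim by (simp add: field_simps power2_eq_square)
    finally show ?case .
  qed
  ultimately have "((\<lambda>h. (energy (t + h) - energy t) / h) \<longlongrightarrow> - ?a) (at_right 0)"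
    using tendsto_sandwich[of "\<lambda>_. - ?a" _ _ _ "- ?a"] by simp
  then show ?thesis
    unfolding has_field_derivative_iff
    by (subst filterlim_at_right_to_0) (simp add: add.commute)
qed

lemma energy_antimono:
  assumes "0 < s" "s \<le> t"
  shows "energy t \<le> energy s"
proof -
  have "(energy has_real_derivative - (norm (\<zeta> r))\<^sup>2) (at_right r)" if "s \<le> r" for r
    using assms(1) that by (intro energy_right_derivative) simp
  moreover have "- (norm (\<zeta> r))\<^sup>2 \<le> 0" for r
    by simp
  ultimately show ?thesis
    using le_of_right_derivative_nonpos[of s t energy "\<lambda>r. - (norm (\<zeta> r))\<^sup>2"]
      assms(2) continuous_on_energy[OF assms(1)] by blast
qed

lemma dist_null_antimono:
  assumes "J x = 0" "0 < s" "s \<le> t"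
  shows "norm (u t - x) \<le> norm (u s - x)"
proof -
  have "(norm (u (s + (t - s)) - x))\<^sup>2 \<le> (norm (u s - x))\<^sup>2 + 2 * (t - s) * 0 + (t - s)\<^sup>2 * 0"
    using assms by (intro dist_sq_le[where j = 0]) (auto simp: energy_nonneg zero_ereal_def)
  then show ?thesis
    by (simp add: abs_le_square_iff[symmetric])
qed

text \<open>
  As the energy is non-increasing, the square of the norm drops by at least \<open>2 m J(u(1 + m))\<close> in time
  \<open>m\<close>, so the energy is \<open>O(1/m)\<close>.  Hence some subsequence converges, to a null point; the distance to
  that point is non-increasing, so the whole curve converges to it.
\<close>

lemma convergent_at_top:
  assumes "precompact_sublevels J"
  obtains l where "J l = 0" "(u \<longlongrightarrow> l) at_top"
proof -
  define C where "C = (norm (u 1))\<^sup>2 / 2"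
  define x where "x n = u (1 + real (Suc n))" for n
  have energy_le: "J (x n) \<le> ereal (C / real (Suc n))" for n
  proof -
    define m where "m = real (Suc n)"
    have "0 < m" by (simp add: m_def)
    have "(norm (u (1 + m) - 0))\<^sup>2 \<le> (norm (u 1 - 0))\<^sup>2 + 2 * m * (- energy (1 + m)) + m\<^sup>2 * 0"
      using \<open>0 < m\<close> by (intro dist_sq_le[where j = 0])
        (auto simp: J_zero zero_ereal_def[symmetric] intro: energy_antimono)
    from order_trans[OF zero_le_power2 this] have "m * energy (1 + m) \<le> C"
      by (simp add: C_def)
    then have "energy (1 + m) \<le> C / m"
      using \<open>0 < m\<close> by (simp add: pos_le_divide_eq mult.commute)
    then show ?thesis
      using \<open>0 < m\<close> J_eq_energy[of "1 + m"] unfolding x_def m_def[symmetric] by simp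
  qed
  have "C / real (Suc n) \<le> C" for n
    by (simp add: C_def pos_divide_le_eq mult_left_mono)
  then have "J (x n) \<le> ereal C" for n
    using energy_le[of n] by (meson ereal_less_eq(3) order_trans)
  moreover have "norm (x n) \<le> norm (u 1)" for n
    using dist_null_antimono[OF J_zero, of 1 "1 + real (Suc n)"] by (simp add: x_def)
  ultimately obtain l r where r: "strict_mono r" and l: "(x \<circ> r) \<longlonglongrightarrow> l"
    using bounded_energy_imp_convergent_subseq[OF assms] by metis
  have "(\<lambda>n. C / real (Suc n)) \<longlonglongrightarrow> 0"
    using tendsto_mult[OF tendsto_const[of C] LIMSEQ_inverse_real_of_nat] by (simp add: field_simps)
  from LIMSEQ_subseq_LIMSEQ[OF this r] have "J l \<le> ereal 0"
    using energy_le by (intro J_le_of_tendsto[OF l]) auto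
  then have null: "J l = 0"
    using J_nonneg[of l] by (simp add: zero_ereal_def antisym)
  have "(u \<longlongrightarrow> l) at_top"
  proof (rule tendstoI)
    fix e :: real assume "0 < e"
    then obtain n where n: "dist ((x \<circ> r) n) l < e"
      using tendstoD[OF l] eventually_happens[of _ sequentially] by (metis sequentially_bot)
    have "eventually (\<lambda>t. 1 + real (Suc (r n)) \<le> t) at_top"
      by (rule eventually_ge_at_top)
    then show "eventually (\<lambda>t. dist (u t) l < e) at_top"
    proof eventually_elim
      case (elim t)
      with dist_null_antimono[OF null _ elim] n show ?case
        by (simp add: dist_norm x_def)
    qed
  qed
  with null that show ?thesis by blast
qed

lemma translate:
  assumes "J l = 0"
  shows "homogeneous_flow J p (\<lambda>t. u t - l) \<zeta>"
proof unfold_locales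
  show "continuous_on {0<..} (\<lambda>t. u t - l)"
    by (intro continuous_intros continuous)
  show "\<zeta> t \<in> subdifferential J (u t - l)" if "0 < t" for t
    using subdifferential_add_null[of "- l" "u t"] subgradient[OF that] assms by (simp add: J_uminus)
  show "((\<lambda>t. u t - l) has_vector_derivative - \<zeta> t) (at_right t)" if "0 < t" for t
    using right_derivative[OF that] by (auto intro!: derivative_eq_intros)
qed


definition rayleigh_quotient :: "real \<Rightarrow> real" where
  "rayleigh_quotient t = p * energy t / norm (u t) powr p"

text \<open>
  The eigenvector residual \<open>\<eta> - \<Lambda> w\<close> of the normalised curve \<open>w = u / \<parallel>u\<parallel>\<close>, where \<open>\<eta> = \<parallel>u\<parallel>\<^sup>1\<^sup>-\<^sup>p \<zeta>\<close> is the
  subgradient at \<open>w\<close> obtained from \<open>\<zeta>\<close> by scaling.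
\<close>

definition defect :: "real \<Rightarrow> 'a" where
  "defect t = ((1 / norm (u t)) powr (p - 1)) *\<^sub>R \<zeta> t - rayleigh_quotient t *\<^sub>R (u t /\<^sub>R norm (u t))"

lemma rayleigh_quotient_nonneg: "0 < t \<Longrightarrow> 0 \<le> rayleigh_quotient t"
  using p_ge_1 energy_nonneg by (simp add: rayleigh_quotient_def)

text \<open>
  By Euler's identity the residual is orthogonal to \<open>u\<close>; up to scaling, its squared length is therefore
  the gap in the Cauchy-Schwarz inequality between \<open>\<zeta>\<close> and \<open>u\<close>.
\<close>

lemma norm_defect_sq:
  assumes "0 < t" "u t \<noteq> 0"
  shows "(norm (defect t))\<^sup>2
    = (norm (u t) powr (- p))\<^sup>2 * ((norm (\<zeta> t))\<^sup>2 * (norm (u t))\<^sup>2 - (p * energy t)\<^sup>2)"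
proof -
  let ?N = "norm (u t)" and ?q = "norm (u t) powr (- p)"
  have N: "0 < ?N" using assms by simp
  have "(1 / ?N) powr (p - 1) = ?q * ?N"
    using N by (simp add: powr_divide powr_diff powr_minus divide_simps)
  then have "defect t = (?q * ?N) *\<^sub>R \<zeta> t - (p * energy t * ?q / ?N) *\<^sub>R u t"
    by (simp add: defect_def rayleigh_quotient_def powr_minus divide_inverse)
  moreover have "(norm (a *\<^sub>R x - b *\<^sub>R y))\<^sup>2 = a\<^sup>2 * (norm x)\<^sup>2 - 2 * a * b * inner x y + b\<^sup>2 * (norm y)\<^sup>2"
    for a b and x y :: 'a
    unfolding power2_norm_eq_inner
    by (simp add: inner_diff_left inner_diff_right inner_commute power2_eq_square algebra_simps)
  ultimately have "(norm (defect t))\<^sup>2 = (?q * ?N)\<^sup>2 * (norm (\<zeta> t))\<^sup>2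
      - 2 * (?q * ?N) * (p * energy t * ?q / ?N) * (p * energy t)
      + (p * energy t * ?q / ?N)\<^sup>2 * ?N\<^sup>2"
    by (simp only: inner_subgradient_flow[OF assms(1)])
  also have "\<dots> = ?q\<^sup>2 * ((norm (\<zeta> t))\<^sup>2 * ?N\<^sup>2 - (p * energy t)\<^sup>2)"
    using N by (simp add: field_simps power2_eq_square)
  finally show ?thesis .
qed

lemma norm_right_derivative:
  assumes "0 < t" "u t \<noteq> 0"
  shows "((\<lambda>s. norm (u s)) has_real_derivative - (p * energy t / norm (u t))) (at_right t)"
  using has_right_derivative_norm[OF right_derivative[OF assms(1)] assms(2)]
  by (simp add: inner_subgradient_flow[OF assms(1)])

lemma rayleigh_quotient_right_derivative:
  assumes "0 < t" "u t \<noteq> 0"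
  shows "(rayleigh_quotient has_real_derivative - (p * norm (u t) powr (p - 2) * (norm (defect t))\<^sup>2)) (at_right t)"
proof -
  let ?N = "norm (u t)"
  have N: "0 < ?N" using assms by simp
  have eq: "rayleigh_quotient = (\<lambda>s. p * (energy s * norm (u s) powr (- p)))"
    by (simp add: fun_eq_iff rayleigh_quotient_def powr_minus divide_inverse)
  have "((\<lambda>s. norm (u s) powr (- p)) has_real_derivative
      (- p * ?N powr (- p - 1)) * - (p * energy t / ?N)) (at_right t)"
    by (rule DERIV_chain2[OF has_real_derivative_powr[OF N] norm_right_derivative[OF assms]])
  from DERIV_cmult[OF DERIV_mult[OF energy_right_derivative[OF assms(1)] this], of p]
  have "(rayleigh_quotient has_real_derivative p * (- (norm (\<zeta> t))\<^sup>2 * ?N powr (- p)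
      + (- p * ?N powr (- p - 1)) * - (p * energy t / ?N) * energy t)) (at_right t)"
    unfolding eq .
  moreover have "p * (- (norm (\<zeta> t))\<^sup>2 * ?N powr (- p)
      + (- p * ?N powr (- p - 1)) * - (p * energy t / ?N) * energy t)
      = - (p * ?N powr (p - 2) * (norm (defect t))\<^sup>2)"
  proof -
    have minus_1: "?N powr (- p - 1) = ?N powr (- p) / ?N"
      using N by (simp add: powr_diff)
    have "?N powr (p - 2) * ?N powr (- p) * ?N\<^sup>2 = 1"
      using N by (simp add: powr_diff powr_minus powr_numeral)
    then have "?N powr (p - 2) * (?N powr (- p))\<^sup>2 = ?N powr (- p) / ?N\<^sup>2"
      using N by (simp add: power2_eq_square field_simps)
    then have "p * (?N powr (p - 2) * (?N powr (- p))\<^sup>2) * ((norm (\<zeta> t))\<^sup>2 * ?N\<^sup>2 - (p * energy t)\<^sup>2)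
        = p * (?N powr (- p) / ?N\<^sup>2) * ((norm (\<zeta> t))\<^sup>2 * ?N\<^sup>2 - (p * energy t)\<^sup>2)"
      by simp
    then have dissipation: "p * ?N powr (p - 2) * (norm (defect t))\<^sup>2
        = p * (?N powr (- p) / ?N\<^sup>2) * ((norm (\<zeta> t))\<^sup>2 * ?N\<^sup>2 - (p * energy t)\<^sup>2)"
      by (simp only: norm_defect_sq[OF assms] mult.assoc)
    show ?thesis
      unfolding minus_1 dissipation using N by (simp add: field_simps power2_eq_square)
  qed
  ultimately show ?thesis
    by simp
qed

lemma ln_norm_right_derivative:
  assumes "0 < t" "u t \<noteq> 0"
  shows "((\<lambda>s. ln (norm (u s))) has_real_derivative - (rayleigh_quotient t * norm (u t) powr (p - 2))) (at_right t)"
proof -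
  let ?N = "norm (u t)"
  have N: "0 < ?N" using assms by simp
  have "((\<lambda>s. ln (norm (u s))) has_real_derivative 1 / ?N * - (p * energy t / ?N)) (at_right t)"
    by (rule DERIV_chain2[OF DERIV_ln_divide[OF N] norm_right_derivative[OF assms]])
  moreover have "1 / ?N * - (p * energy t / ?N) = - (rayleigh_quotient t * ?N powr (p - 2))"
    using N by (simp add: rayleigh_quotient_def powr_diff powr_numeral power2_eq_square)
  ultimately show ?thesis
    by simp
qed

lemma continuous_on_rayleigh_quotient:
  assumes "0 < a" "\<And>t. a \<le> t \<Longrightarrow> t \<le> b \<Longrightarrow> u t \<noteq> 0"
  shows "continuous_on {a..b} rayleigh_quotient"
proof -
  have "continuous_on {a..b} (\<lambda>t. p * energy t / norm (u t) powr p)"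
    using assms by (intro continuous_intros continuous_on_energy continuous_on_interval) auto
  then show ?thesis
    by (simp add: rayleigh_quotient_def[abs_def])
qed

lemma rayleigh_quotient_antimono:
  assumes "0 < s" "s \<le> t" "\<And>r. s \<le> r \<Longrightarrow> r \<le> t \<Longrightarrow> u r \<noteq> 0"
  shows "rayleigh_quotient t \<le> rayleigh_quotient s"
proof (rule le_of_right_derivative_nonpos[where \<phi> = rayleigh_quotient])
  show "continuous_on {s..t} rayleigh_quotient"
    by (rule continuous_on_rayleigh_quotient) (use assms in auto)
  fix r assume "s \<le> r" "r < t"
  then show "(rayleigh_quotient has_real_derivative
      - (p * norm (u r) powr (p - 2) * (norm (defect r))\<^sup>2)) (at_right r)"
    using assms by (intro rayleigh_quotient_right_derivative) auto
  show "- (p * norm (u r) powr (p - 2) * (norm (defect r))\<^sup>2) \<le> 0"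
    using p_ge_1 by simp
qed (rule assms)

text \<open>
  If the defect were at least \<open>\<delta>\<close> from \<open>t0\<close> on, then \<open>\<Lambda> - c ln \<parallel>u\<parallel>\<close> would be non-increasing, for a
  \<open>c > 0\<close> such that \<open>c \<Lambda> \<le> p \<delta>\<^sup>2\<close>.  As \<open>\<Lambda> \<ge> 0\<close>, this keeps \<open>\<parallel>u\<parallel>\<close> away from zero.
\<close>

lemma small_defect:
  assumes t0: "0 < t0" "ereal t0 < T"
    and nonzero: "\<And>t. 0 < t \<Longrightarrow> ereal t < T \<Longrightarrow> u t \<noteq> 0"
    and vanishing: "\<And>\<epsilon>. 0 < \<epsilon> \<Longrightarrow> \<exists>t>0. ereal t < T \<and> norm (u t) < \<epsilon>"
    and "0 < \<delta>"
  shows "\<exists>t\<ge>t0. ereal t < T \<and> norm (defect t) < \<delta>"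
proof (rule ccontr)
  assume "\<not> ?thesis"
  then have large: "\<delta> \<le> norm (defect t)" if "t0 \<le> t" "ereal t < T" for t
    using that by force
  \<comment> \<open>The summand \<open>1\<close> makes \<open>K\<close> positive even if the quotient vanishes.\<close>
  define K where "K = rayleigh_quotient t0 + 1"
  have "0 < K"
    using rayleigh_quotient_nonneg[OF t0(1)] by (simp add: K_def)
  define c where "c = p * \<delta>\<^sup>2 / K"
  have "0 < c"
    using \<open>0 < K\<close> \<open>0 < \<delta>\<close> p_ge_1 by (simp add: c_def)
  define \<phi> where "\<phi> t = rayleigh_quotient t - c * ln (norm (u t))" for t
  have bound: "\<phi> b \<le> \<phi> t0" if b: "t0 \<le> b" "ereal b < T" for b
  proof (rule le_of_right_derivative_nonpos[where \<phi> = \<phi>])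
    have nz: "u r \<noteq> 0" if "t0 \<le> r" "r \<le> b" for r
      using that b t0 by (intro nonzero) (auto intro: le_less_trans[of _ "ereal b"])
    show "continuous_on {t0..b} \<phi>"
      unfolding \<phi>_def using t0 nz
      by (intro continuous_intros continuous_on_rayleigh_quotient continuous_on_interval) auto
    fix r assume r: "t0 \<le> r" "r < b"
    then have "0 < r" "u r \<noteq> 0" "ereal r < T"
      using t0 nz b by (auto intro: less_trans[of _ "ereal b"])
    let ?M = "norm (u r) powr (p - 2)"
    show "(\<phi> has_real_derivative - (p * ?M * (norm (defect r))\<^sup>2) - c * - (rayleigh_quotient r * ?M)) (at_right r)"
      unfolding \<phi>_def
      by (intro DERIV_diff DERIV_cmult rayleigh_quotient_right_derivative ln_norm_right_derivative \<open>0 < r\<close> \<open>u r \<noteq> 0\<close>)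
    have "rayleigh_quotient r \<le> K"
      using rayleigh_quotient_antimono[OF t0(1) r(1)] nz r unfolding K_def by fastforce
    then have "c * rayleigh_quotient r \<le> c * K"
      using \<open>0 < c\<close> by (intro mult_left_mono) auto
    also have "c * K = p * \<delta>\<^sup>2"
      using \<open>0 < K\<close> by (simp add: c_def)
    also have "\<dots> \<le> p * (norm (defect r))\<^sup>2"
      using large[OF r(1) \<open>ereal r < T\<close>] \<open>0 < \<delta>\<close> p_ge_1 by (intro mult_left_mono power_mono) auto
    finally have "c * rayleigh_quotient r * ?M \<le> p * (norm (defect r))\<^sup>2 * ?M"
      by (rule mult_right_mono) simp
    then show "- (p * ?M * (norm (defect r))\<^sup>2) - c * - (rayleigh_quotient r * ?M) \<le> 0"
      by (simp add: algebra_simps)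
  qed (use b in simp)
  \<comment> \<open>Chosen so that \<open>\<parallel>u b\<parallel> < \<epsilon>\<close> forces \<open>- c ln \<parallel>u b\<parallel> > \<phi> t0 + c\<close>, and hence \<open>\<phi> b > \<phi> t0\<close>.\<close>
  define \<epsilon> where "\<epsilon> = exp (- \<phi> t0 / c - 1)"
  obtain t where t: "0 < t" "ereal t < T" "norm (u t) < \<epsilon>"
    using vanishing[of \<epsilon>] by (auto simp: \<epsilon>_def)
  define b where "b = max t0 t"
  have b: "t0 \<le> b" "ereal b < T" "0 < b"
    using t t0 by (auto simp: b_def max_def)
  have "norm (u b) < \<epsilon>"
    using dist_null_antimono[OF J_zero t(1), of b] t by (simp add: b_def)
  then have "ln (norm (u b)) < ln \<epsilon>"
    using nonzero[OF b(3,2)] by (subst ln_less_cancel_iff) (auto simp: \<epsilon>_def)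
  then have "ln (norm (u b)) < - \<phi> t0 / c - 1"
    by (simp add: \<epsilon>_def)
  then have "c * ln (norm (u b)) < - \<phi> t0 - c"
    using \<open>0 < c\<close> by (simp add: field_simps)
  then have "\<phi> t0 < \<phi> b"
    using rayleigh_quotient_nonneg[OF b(3)] \<open>0 < c\<close> by (simp add: \<phi>_def)
  with bound[OF b(1,2)] show False
    by simp
qed

lemma J_rescaled:
  assumes "0 < t" "u t \<noteq> 0"
  shows "J (u t /\<^sub>R norm (u t)) = ereal (rayleigh_quotient t / p)"
  using J_scale[of "1 / norm (u t)" "u t"] assms p_ge_1
  by (simp add: J_eq_energy rayleigh_quotient_def powr_divide inverse_eq_divide)

lemma rescaled_subgradient:
  assumes "0 < t" "u t \<noteq> 0"
  shows "defect t + rayleigh_quotient t *\<^sub>R (u t /\<^sub>R norm (u t)) \<in> subdifferential J (u t /\<^sub>R norm (u t))"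
  using subdifferential_scale[OF subgradient[OF assms(1)], of "1 / norm (u t)"] assms
  by (simp add: defect_def inverse_eq_divide)

lemma rayleigh_quotient_INF_finite:
  assumes "0 < T"
  obtains \<Lambda> where "ereal \<Lambda> = (INF t\<in>{t. 0 < t \<and> ereal t < T}. ereal (rayleigh_quotient t))"
proof -
  let ?I = "INF t\<in>{t. 0 < t \<and> ereal t < T}. ereal (rayleigh_quotient t)"
  obtain t where "0 < t" "ereal t < T"
    using ereal_dense2[OF assms] by (auto simp: zero_ereal_def)
  then have "?I \<le> ereal (rayleigh_quotient t)"
    by (intro INF_lower) simp
  moreover have "0 \<le> ?I"
    by (intro INF_greatest) (auto simp: rayleigh_quotient_nonneg)
  ultimately show ?thesis
    by (intro that[of "real_of_ereal ?I"]) (cases ?I; simp)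
qed

lemma rayleigh_quotient_tendsto_INF:
  assumes "0 < T"
    and nonzero: "\<And>t. 0 < t \<Longrightarrow> ereal t < T \<Longrightarrow> u t \<noteq> 0"
  shows "((\<lambda>x. ereal (rayleigh_quotient (real_of_ereal x))) \<longlongrightarrow>
    (INF t\<in>{t. 0 < t \<and> ereal t < T}. ereal (rayleigh_quotient t))) (at_left T)"
    (is "(_ \<longlongrightarrow> ?I) _")
proof (rule decreasing_tendsto)
  have "eventually (\<lambda>x. x \<in> {0<..<T}) (at_left T)"
    by (rule eventually_at_leftI[OF _ assms(1)])
  then show "eventually (\<lambda>x. ?I \<le> ereal (rayleigh_quotient (real_of_ereal x))) (at_left T)"
  proof eventually_elim
    case (elim x)
    then show ?case
      by (cases x) (auto intro!: INF_lower)
  qed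
next
  fix y assume "?I < y"
  then obtain t where t: "0 < t" "ereal t < T" "ereal (rayleigh_quotient t) < y"
    by (auto simp: INF_less_iff)
  have "eventually (\<lambda>x. x \<in> {ereal t<..<T}) (at_left T)"
    by (rule eventually_at_leftI[OF _ t(2)])
  then show "eventually (\<lambda>x. ereal (rayleigh_quotient (real_of_ereal x)) < y) (at_left T)"
  proof eventually_elim
    case (elim x)
    then obtain s where s: "x = ereal s" "t < s" "ereal s < T"
      by (cases x) auto
    have "rayleigh_quotient s \<le> rayleigh_quotient t"
      using s t by (intro rayleigh_quotient_antimono nonzero) (auto intro: le_less_trans[of _ "ereal s"])
    then show ?case
      using t(3) s(1) by (auto intro: le_less_trans[of _ "ereal (rayleigh_quotient t)"])
  qed
qed

text \<open>
  The subgradients \<open>\<eta> = defect + \<Lambda> w\<close> at \<open>w\<close> converge strongly once the defect tends to \<open>0\<close> and \<open>w\<close>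
  converges, so that closedness of the subdifferential applies.
\<close>

lemma rescaled_limit_point:
  assumes compact: "precompact_sublevels J" and "0 < T"
    and nonzero: "\<And>t. 0 < t \<Longrightarrow> ereal t < T \<Longrightarrow> u t \<noteq> 0"
    and vanishing: "\<And>\<epsilon>. 0 < \<epsilon> \<Longrightarrow> \<exists>t>0. ereal t < T \<and> norm (u t) < \<epsilon>"
    and \<Lambda>: "ereal \<Lambda> = (INF t\<in>{t. 0 < t \<and> ereal t < T}. ereal (rayleigh_quotient t))"
  obtains t w where "incseq t" "\<And>n. 0 < t n" "\<And>n. ereal (t n) < T" "(\<lambda>n. ereal (t n)) \<longlonglongrightarrow> T"
    "(\<lambda>n. u (t n) /\<^sub>R norm (u (t n))) \<longlonglongrightarrow> w" "\<Lambda> *\<^sub>R w \<in> subdifferential J w"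
proof -
  obtain X where X: "\<And>n. 0 < ereal (X n)" "\<And>n. ereal (X n) < T" "(\<lambda>n. ereal (X n)) \<longlonglongrightarrow> T"
    using ereal_incseq_approx[OF \<open>0 < T\<close>] by metis
  \<comment> \<open>The times are pushed beyond \<open>X n\<close> so that they exhaust the lifetime \<open>T\<close>, and each is chosen after the
    previous one so that they increase.\<close>
  define P where "P n s \<longleftrightarrow> X n \<le> s \<and> ereal s < T \<and> norm (defect s) < inverse (real (Suc n))" for n s
  have next_time: "\<exists>s. P n s \<and> r \<le> s" if "ereal r < T" for n r
  proof -
    have "\<exists>s\<ge>max (X n) r. ereal s < T \<and> norm (defect s) < inverse (real (Suc n))"
      using X(1,2)[of n] that by (intro small_defect nonzero vanishing) (auto simp: max_def)
    then show ?thesis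
      by (auto simp: P_def)
  qed
  have "\<exists>t. \<forall>n. P n (t n) \<and> t n \<le> t (Suc n)"
  proof (rule dependent_nat_choice)
    show "\<exists>s. P 0 s"
      using next_time[OF X(2)] by blast
    show "\<exists>s. P (Suc n) s \<and> r \<le> s" if "P n r" for r n
      using that by (intro next_time) (simp add: P_def)
  qed
  then obtain t where P: "\<And>n. P n (t n)" and t_Suc: "\<And>n. t n \<le> t (Suc n)"
    by blast
  have t: "X n \<le> t n" "0 < t n" "ereal (t n) < T" "norm (defect (t n)) < inverse (real (Suc n))" for n
    using P[of n] X(1)[of n] by (auto simp: P_def)
  have inc: "incseq t"
    using t_Suc by (rule incseq_SucI)
  have t_lim: "(\<lambda>n. ereal (t n)) \<longlonglongrightarrow> T"
    by (rule tendsto_sandwich[OF _ _ X(3) tendsto_const]) (auto simp: t less_imp_le)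
  have nz: "u (t n) \<noteq> 0" for n
    by (intro nonzero t)
  define w where "w n = u (t n) /\<^sub>R norm (u (t n))" for n
  have "filterlim (\<lambda>n. ereal (t n)) (at_left T) sequentially"
    using t_lim by (simp add: filterlim_at t(3) less_imp_neq[OF t(3)])
  from filterlim_compose[OF rayleigh_quotient_tendsto_INF[OF \<open>0 < T\<close> nonzero] this]
  have quot_lim: "(\<lambda>n. rayleigh_quotient (t n)) \<longlonglongrightarrow> \<Lambda>"
    by (simp add: \<Lambda>[symmetric])
  have defect_lim: "(\<lambda>n. defect (t n)) \<longlonglongrightarrow> 0"
    by (rule Lim_null_comparison[OF _ LIMSEQ_inverse_real_of_nat])
      (intro always_eventually allI less_imp_le t)
  have "norm (w n) \<le> 1" for n
    using nz[of n] by (simp add: w_def)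
  moreover have "J (w n) \<le> ereal (rayleigh_quotient (t 0) / p)" for n
  proof -
    have "rayleigh_quotient (t n) \<le> rayleigh_quotient (t 0)"
    proof (rule rayleigh_quotient_antimono)
      show "t 0 \<le> t n"
        using inc by (simp add: incseq_def)
      fix r assume "t 0 \<le> r" "r \<le> t n"
      then show "u r \<noteq> 0"
        using t[of 0] t[of n] by (intro nonzero) (auto intro: le_less_trans[of _ "ereal (t n)"])
    qed (rule t)
    then show ?thesis
      using p_ge_1 by (simp add: w_def J_rescaled[OF t(2) nz] divide_right_mono)
  qed
  ultimately obtain l r where r: "strict_mono r" and l: "(w \<circ> r) \<longlonglongrightarrow> l"
    using bounded_energy_imp_convergent_subseq[OF compact] by metis
  have "(\<lambda>n. defect (t (r n)) + rayleigh_quotient (t (r n)) *\<^sub>R w (r n)) \<longlonglongrightarrow> 0 + \<Lambda> *\<^sub>R l"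
    using LIMSEQ_subseq_LIMSEQ[OF defect_lim r] LIMSEQ_subseq_LIMSEQ[OF quot_lim r] l
    by (intro tendsto_intros) (simp_all add: o_def)
  then have "0 + \<Lambda> *\<^sub>R l \<in> subdifferential J l"
    by (rule subdifferential_closed[OF l]) (simp only: w_def o_def rescaled_subgradient[OF t(2) nz])
  then have "\<Lambda> *\<^sub>R l \<in> subdifferential J l"
    by simp
  moreover have "incseq (t \<circ> r)"
    using inc strict_mono_mono[OF r] by (auto simp: incseq_def mono_def)
  moreover have "(\<lambda>n. ereal ((t \<circ> r) n)) \<longlonglongrightarrow> T"
    using LIMSEQ_subseq_LIMSEQ[OF t_lim r] by (simp add: o_def)
  moreover have "(\<lambda>n. u ((t \<circ> r) n) /\<^sub>R norm (u ((t \<circ> r) n))) \<longlonglongrightarrow> l"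
    using l by (simp add: w_def o_def)
  ultimately show ?thesis
    using t(2,3) by (intro that[of "t \<circ> r" l]) auto
qed

text \<open>
  When \<open>T\<close> is infinite this is the assumed decay at infinity.  When it is finite, the curve stays at \<open>0\<close>
  after each of its zeros, hence vanishes on \<open>(T, \<infinity>)\<close>; continuity from the right gives \<open>u T = 0\<close>, and
  continuity from the left smallness before \<open>T\<close>.
\<close>

lemma vanishing_before_zero_infimum:
  assumes T: "T = Inf (ereal ` {t. 0 < t \<and> u t = 0})" and "0 < T"
    and lim: "(u \<longlongrightarrow> 0) at_top" and "0 < \<epsilon>"
  shows "\<exists>t>0. ereal t < T \<and> norm (u t) < \<epsilon>"
proof (cases T)
  case PInf
  have "eventually (\<lambda>t. norm (u t) < \<epsilon> \<and> 0 < t) at_top"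
    using tendstoD[OF lim \<open>0 < \<epsilon>\<close>] eventually_gt_at_top[of 0]
    by (intro eventually_conj) auto
  then have "\<exists>t. norm (u t) < \<epsilon> \<and> 0 < t"
    by (rule eventually_happens'[rotated]) simp
  then show ?thesis
    using PInf by auto
next
  case (real T')
  then have "0 < T'" using \<open>0 < T\<close> by simp
  have after: "u s = 0" if "T' < s" for s
  proof -
    have "Inf (ereal ` {t. 0 < t \<and> u t = 0}) < ereal s"
      using that real T by simp
    then obtain r where "0 < r" "u r = 0" "r < s"
      by (auto simp: Inf_less_iff)
    then show ?thesis
      using dist_null_antimono[OF J_zero, of r s] by simp
  qed
  have cont: "(u \<longlongrightarrow> u T') (at T')"
    using continuous \<open>0 < T'\<close> by (simp add: continuous_on_eq_continuous_at isCont_def)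
  have "eventually (\<lambda>s. u s = 0) (at_right T')"
    using eventually_at_right_less[of T'] by eventually_elim (rule after)
  then have "((\<lambda>_. 0) \<longlongrightarrow> u T') (at_right T')"
    by (rule Lim_transform_eventually[rotated]) (use cont in \<open>simp add: filterlim_at_split\<close>)
  then have "u T' = 0"
    by (simp add: tendsto_const_iff)
  then have "(u \<longlongrightarrow> 0) (at_left T')"
    using cont by (simp add: filterlim_at_split)
  from tendstoD[OF this \<open>0 < \<epsilon>\<close>] eventually_at_left_real[OF \<open>0 < T'\<close>]
  have "eventually (\<lambda>t. norm (u t) < \<epsilon> \<and> 0 < t \<and> t < T') (at_left T')"
    by eventually_elim auto
  then have "\<exists>t. norm (u t) < \<epsilon> \<and> 0 < t \<and> t < T'"
    by (rule eventually_happens'[rotated]) simp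
  then show ?thesis
    using real by auto
qed (use \<open>0 < T\<close> in simp)

end

section \<open>The rescaled gradient flow\<close>

theorem theorem2p73:
  fixes J :: "'a::{real_inner, complete_space} \<Rightarrow> ereal"
    and p :: real and f :: 'a and u :: "real \<Rightarrow> 'a"
  assumes "p \<ge> 1"
    and "no_minus_infty J"
    and "abs_homogeneous p J"
    and "proper_fun J"
    and "convex_fun J"
    and "lower_semicont J"
    and "precompact_sublevels J"
    and "f \<in> closure (eff_dom J)"
    and "gradient_flow J f u"
    and "f \<noteq> flow_limit u"
  shows "\<exists>\<Lambda>_inf::real.
    ((rayleigh p J u \<circ> real_of_ereal) \<longlongrightarrow> ereal \<Lambda>_inf) (at_left (extinction_time u)) \<and>
    ereal \<Lambda>_inf = (INF t\<in>{t. 0 < t \<and> ereal t < extinction_time u}. rayleigh p J u t) \<and>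
    (\<exists>(t :: nat \<Rightarrow> real) w_inf.
       incseq t \<and>
       (\<forall>n. 0 \<le> t n \<and> ereal (t n) < extinction_time u) \<and>
       (\<lambda>n. ereal (t n)) \<longlonglongrightarrow> extinction_time u \<and>
       (\<lambda>n. rescaled_flow u (t n)) \<longlonglongrightarrow> w_inf \<and>
       \<Lambda>_inf *\<^sub>R w_inf \<in> subdifferential J w_inf)"
proof -
  interpret homogeneous_functional J p
    using assms(1-6) by unfold_locales
  define T where "T = extinction_time u"
  have u0: "u 0 = f" and cont: "continuous_on {0..} u"
    using assms(9) by (auto simp: gradient_flow_def)
  have "\<forall>t. \<exists>z. 0 < t \<longrightarrow> z \<in> subdifferential J (u t) \<and> (u has_vector_derivative - z) (at_right t)"
    using assms(9) unfolding gradient_flow_def is_arg_min_def by blast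
  then obtain \<zeta> where \<zeta>: "\<And>t. 0 < t \<Longrightarrow> \<zeta> t \<in> subdifferential J (u t)"
    "\<And>t. 0 < t \<Longrightarrow> (u has_vector_derivative - \<zeta> t) (at_right t)"
    by metis
  have "continuous_on {0<..} u"
    by (rule continuous_on_subset[OF cont]) auto
  then interpret u: homogeneous_flow J p u \<zeta>
    using \<zeta> by unfold_locales
  obtain l where null: "J l = 0" and lim: "(u \<longlongrightarrow> l) at_top"
    using u.convergent_at_top[OF assms(7)] .
  have l: "flow_limit u = l"
    unfolding flow_limit_def by (rule tendsto_Lim[OF _ lim]) simp
  interpret g: homogeneous_flow J p "\<lambda>t. u t - l" \<zeta>
    by (rule u.translate[OF null])
  have T: "T = Inf (ereal ` {t. 0 < t \<and> u t - l = 0})"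
    by (simp add: T_def extinction_time_def l)
  have nonzero: "u t - l \<noteq> 0" if "0 < t" "ereal t < T" for t
  proof
    assume "u t - l = 0"
    then have "T \<le> ereal t"
      unfolding T using \<open>0 < t\<close> by (intro Inf_lower) auto
    with \<open>ereal t < T\<close> show False by simp
  qed
  have "0 < T"
  proof -
    have "(u \<longlongrightarrow> f) (at 0 within {0..})"
      using cont u0 by (auto simp: continuous_on_def)
    then have "eventually (\<lambda>t. u t \<noteq> l) (at 0 within {0..})"
      by (rule tendsto_imp_eventually_ne) (use assms(10) l in simp)
    then obtain d where d: "0 < d" "\<And>t. 0 < t \<Longrightarrow> t < d \<Longrightarrow> u t \<noteq> l"
      by (auto simp: eventually_at)
    then have "ereal d \<le> T"
      unfolding T by (intro Inf_greatest) force
    with d(1) show ?thesis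
      by (cases T) auto
  qed
  have vanishing: "\<exists>t>0. ereal t < T \<and> norm (u t - l) < \<epsilon>" if "0 < \<epsilon>" for \<epsilon>
    using T \<open>0 < T\<close> _ that
    by (rule g.vanishing_before_zero_infimum) (use lim in \<open>simp add: LIM_zero_iff\<close>)
  have rayleigh: "rayleigh p J u t = ereal (g.rayleigh_quotient t)" if "0 < t" "ereal t < T" for t
  proof -
    have "J (u t) = ereal (g.energy t)"
      using g.J_eq_energy[OF \<open>0 < t\<close>] J_add_null[of "- l" "u t"] null by (simp add: J_uminus)
    then show ?thesis
      using nonzero[OF that] by (simp add: rayleigh_def l g.rayleigh_quotient_def)
  qed
  obtain \<Lambda> where \<Lambda>: "ereal \<Lambda> = (INF t\<in>{t. 0 < t \<and> ereal t < T}. ereal (g.rayleigh_quotient t))"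
    using g.rayleigh_quotient_INF_finite[OF \<open>0 < T\<close>] .
  have "eventually (\<lambda>x. x \<in> {0<..<T}) (at_left T)"
    by (rule eventually_at_leftI[OF _ \<open>0 < T\<close>])
  then have "eventually (\<lambda>x. ereal (g.rayleigh_quotient (real_of_ereal x)) = (rayleigh p J u \<circ> real_of_ereal) x) (at_left T)"
  proof eventually_elim
    case (elim x)
    then show ?case
      by (cases x) (auto simp: rayleigh)
  qed
  with g.rayleigh_quotient_tendsto_INF[OF \<open>0 < T\<close> nonzero]
  have "((rayleigh p J u \<circ> real_of_ereal) \<longlongrightarrow> ereal \<Lambda>) (at_left T)"
    unfolding \<Lambda> by (rule Lim_transform_eventually)
  moreover have "ereal \<Lambda> = (INF t\<in>{t. 0 < t \<and> ereal t < T}. rayleigh p J u t)"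
    unfolding \<Lambda> by (rule INF_cong) (auto simp: rayleigh)
  moreover obtain t w where "incseq t" "\<And>n. 0 < t n" "\<And>n. ereal (t n) < T" "(\<lambda>n. ereal (t n)) \<longlonglongrightarrow> T"
    "(\<lambda>n. (u (t n) - l) /\<^sub>R norm (u (t n) - l)) \<longlonglongrightarrow> w" "\<Lambda> *\<^sub>R w \<in> subdifferential J w"
    using g.rescaled_limit_point[OF assms(7) \<open>0 < T\<close> nonzero vanishing \<Lambda>] by blast
  then have "incseq t \<and> (\<forall>n. 0 \<le> t n \<and> ereal (t n) < T) \<and> (\<lambda>n. ereal (t n)) \<longlonglongrightarrow> T \<and>
    (\<lambda>n. rescaled_flow u (t n)) \<longlonglongrightarrow> w \<and> \<Lambda> *\<^sub>R w \<in> subdifferential J w"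
    by (simp add: rescaled_flow_def l less_imp_le)
  ultimately show ?thesis
    unfolding T_def[symmetric] by blast
qed

end
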